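(* Let $d \geq 6$ and $r \geq 1$ be fixed integers. For every $k \in \mathbb{N}$, \textsc{List $(d,r)$-Coloring} can be solved in polynomial time on $kP_3$-free graphs.
   Context: All graphs are finite and simple. $P_s$ denotes the chordless path on $s$ vertices and $kP_3$ the disjoint union of $k$ copies of $P_3$. A graph is $H$-free if it contains no induced subgraph isomorphic to $H$. For $d\geq 2$, a $(d,r)$-coloring of a graph $G$ is a map $\phi:V(G)\to\{1,\dots,r\}$ such that any two distinct vertices at distance less than $d$ in $G$ receive different colors. An $r$-list assignment of $G$ is a function $L: V(G)\to 2^{\{1,\dots,r\}}$. \textsc{List $(d,r)$-Coloring} ($d,r$ fixed): given a graph $G$ and an $r$-list assignment $L$, decide whether $G$ admits a $(d,r)$-coloring $\phi$ with $\phi(u)\in L(u)$ for every $u\in V(G)$. *)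

theory Defs
  imports "Graph_Theory.Graph_Theory" "HOL-Computational_Algebra.Polynomial"
begin

section \<open>Graphs\<close>

text \<open>
  A finite simple graph is a \<^locale>\<open>pair_graph\<close>: a finite, loop-free, symmetric digraph without
  parallel arcs, an undirected edge being the two arcs between its ends.
\<close>

definition path_graph :: "nat \<Rightarrow> nat pair_pre_digraph" where
  "path_graph s =
     \<lparr> pverts = {..<s}, parcs = {(i, j). i < s \<and> j < s \<and> (j = Suc i \<or> i = Suc j)} \<rparr>"

definition disjoint_copies :: "nat \<Rightarrow> 'a pair_pre_digraph \<Rightarrow> (nat \<times> 'a) pair_pre_digraph" where
  "disjoint_copies k H =
     \<lparr> pverts = {..<k} \<times> pverts H,
       parcs = {((i, u), (j, v)). i < k \<and> i = j \<and> (u, v) \<in> parcs H} \<rparr>"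

definition induced_free :: "'b pair_pre_digraph \<Rightarrow> 'a pair_pre_digraph \<Rightarrow> bool" where
  "induced_free H G \<longleftrightarrow>
     \<not> (\<exists>F. induced_subgraph F (with_proj G) \<and> digraph_iso F (with_proj H))"

text \<open>
  With unit weights, \<^const>\<open>wf_digraph.\<mu>\<close> is the usual distance, infinite between different
  components.
\<close>

definition graph_dist :: "'a pair_pre_digraph \<Rightarrow> 'a \<Rightarrow> 'a \<Rightarrow> ereal" where
  "graph_dist G = wf_digraph.\<mu> (with_proj G) (\<lambda>_. 1)"

definition dr_coloring :: "nat \<Rightarrow> nat \<Rightarrow> 'a pair_pre_digraph \<Rightarrow> ('a \<Rightarrow> nat) \<Rightarrow> bool" where
  "dr_coloring d r G \<phi> \<longleftrightarrow>
     (\<forall>u \<in> pverts G. \<phi> u \<in> {1..r}) \<and>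
     (\<forall>u \<in> pverts G. \<forall>v \<in> pverts G.
        u \<noteq> v \<and> graph_dist G u v < ereal (real d) \<longrightarrow> \<phi> u \<noteq> \<phi> v)"

definition list_assignment :: "nat \<Rightarrow> 'a pair_pre_digraph \<Rightarrow> ('a \<Rightarrow> nat set) \<Rightarrow> bool" where
  "list_assignment r G L \<longleftrightarrow> (\<forall>u \<in> pverts G. L u \<subseteq> {1..r})"


section \<open>Polynomial time\<close>

text \<open>
  The machine is a random access machine with a read-only binary input, programmed by
  while-programs. A state gives the contents of the registers, all of which are initially zero.
  Every basic command and every test takes one step. Addition and truncated subtraction are the
  only arithmetic operations: with them, register contents have at most linearly many bits in the
  number of steps, so the unit-cost measure is polynomially related to Turing machine time (this
  would fail with multiplication).
\<close>

type_synonym state = "nat \<Rightarrow> nat"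

datatype com =
    Const nat nat
  | Add nat nat nat
  | Sub nat nat nat
  | Load nat nat
  | Store nat nat
  | Read nat nat
  | Seq com com
  | Cond nat com com
  | While nat com

text \<open>Input bits read as 0 or 1, and positions beyond the end of the input read as 2.\<close>

definition input_at :: "bool list \<Rightarrow> nat \<Rightarrow> nat" where
  "input_at w i = (if i < length w then of_bool (w ! i) else 2)"

text \<open>
  \<open>exec w c s t s'\<close>: on input \<open>w\<close>, program \<open>c\<close> started in state \<open>s\<close> halts after exactly \<open>t\<close>
  steps in state \<open>s'\<close>.
\<close>

inductive exec :: "bool list \<Rightarrow> com \<Rightarrow> state \<Rightarrow> nat \<Rightarrow> state \<Rightarrow> bool" for w where
  Const: "exec w (Const a n) s 1 (s(a := n))"
| Add: "exec w (Add a b c) s 1 (s(a := s b + s c))"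
| Sub: "exec w (Sub a b c) s 1 (s(a := s b - s c))"
| Load: "exec w (Load a b) s 1 (s(a := s (s b)))"
| Store: "exec w (Store a b) s 1 (s(s a := s b))"
| Read: "exec w (Read a b) s 1 (s(a := input_at w (s b)))"
| Seq: "exec w p s t s' \<Longrightarrow> exec w q s' t' s'' \<Longrightarrow> exec w (Seq p q) s (t + t') s''"
| CondTrue: "s a \<noteq> 0 \<Longrightarrow> exec w p s t s' \<Longrightarrow> exec w (Cond a p q) s (Suc t) s'"
| CondFalse: "s a = 0 \<Longrightarrow> exec w q s t s' \<Longrightarrow> exec w (Cond a p q) s (Suc t) s'"
| WhileFalse: "s a = 0 \<Longrightarrow> exec w (While a p) s 1 s"
| WhileTrue: "s a \<noteq> 0 \<Longrightarrow> exec w p s t s' \<Longrightarrow> exec w (While a p) s' t' s'' \<Longrightarrow>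
    exec w (While a p) s (Suc (t + t')) s''"

inductive_cases exec_ConstE: "exec w (Const a n) s t s'"
inductive_cases exec_AddE: "exec w (Add a b c) s t s'"
inductive_cases exec_SubE: "exec w (Sub a b c) s t s'"
inductive_cases exec_LoadE: "exec w (Load a b) s t s'"
inductive_cases exec_StoreE: "exec w (Store a b) s t s'"
inductive_cases exec_ReadE: "exec w (Read a b) s t s'"
inductive_cases exec_SeqE: "exec w (Seq p q) s t s'"
inductive_cases exec_CondE: "exec w (Cond a p q) s t s'"
inductive_cases exec_WhileE: "exec w (While a p) s t s'"

lemma exec_deterministic:
  "exec w c s t s' \<Longrightarrow> exec w c s u s'' \<Longrightarrow> t = u \<and> s' = s''"
proof (induction arbitrary: u s'' rule: exec.induct)
  case (Seq p s t s1 q t' s2)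
  from Seq.prems obtain v v' r where "u = v + v'" "exec w p s v r" "exec w q r v' s''"
    by (rule exec_SeqE)
  with Seq.IH show ?case by metis
next
  case (CondTrue s a p t s1 q)
  from CondTrue.prems CondTrue.hyps obtain v where "u = Suc v" "exec w p s v s''"
    by (elim exec_CondE) simp_all
  with CondTrue.IH show ?case by metis
next
  case (CondFalse s a q t s1 p)
  from CondFalse.prems CondFalse.hyps obtain v where "u = Suc v" "exec w q s v s''"
    by (elim exec_CondE) simp_all
  with CondFalse.IH show ?case by metis
next
  case (WhileFalse s a p)
  from WhileFalse.prems show ?case by (rule exec_WhileE) (use WhileFalse.hyps in simp_all)
next
  case (WhileTrue s a p t s1 t' s2)
  from WhileTrue.prems obtain v v' r
    where "u = Suc (v + v')" "exec w p s v r" "exec w (While a p) r v' s''"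
    by (rule exec_WhileE) (use WhileTrue.hyps in simp_all)
  with WhileTrue.IH show ?case by metis
next
  case (Const a n s)
  then show ?case by (auto elim: exec_ConstE)
next
  case (Add a b c s)
  then show ?case by (auto elim: exec_AddE)
next
  case (Sub a b c s)
  then show ?case by (auto elim: exec_SubE)
next
  case (Load a b s)
  then show ?case by (auto elim: exec_LoadE)
next
  case (Store a b s)
  then show ?case by (auto elim: exec_StoreE)
next
  case (Read a b s)
  then show ?case by (auto elim: exec_ReadE)
qed

text \<open>
  A decision problem \<open>Q\<close> restricted to a class \<open>X\<close> of instances is a promise problem: one program
  must halt within a polynomial bound in the length of the encoding, with the correct answer, on
  every instance in \<open>X\<close>. It accepts iff register 0 is nonzero on halting.
\<close>

definition poly_time_solvable :: "('i \<Rightarrow> bool list) \<Rightarrow> 'i set \<Rightarrow> ('i \<Rightarrow> bool) \<Rightarrow> bool" where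
  "poly_time_solvable enc X Q \<longleftrightarrow>
     (\<exists>(c :: com) (p :: nat poly). \<forall>x \<in> X. \<exists>t s.
        exec (enc x) c (\<lambda>_. 0) t s \<and> t \<le> poly p (length (enc x)) \<and> (s 0 \<noteq> 0 \<longleftrightarrow> Q x))"


section \<open>The list colouring problem\<close>

text \<open>
  An instance is a graph with a list assignment, together with an arbitrary enumeration \<open>vs\<close> of the
  vertices, which fixes the order in which they appear in the encoding. An instance with \<open>n\<close>
  vertices is encoded as \<open>n\<close> in unary, followed by the adjacency matrix and the \<open>n\<close>-by-\<open>r\<close>
  incidence matrix of the lists.
\<close>

type_synonym list_instance = "nat list \<times> nat pair_pre_digraph \<times> (nat \<Rightarrow> nat set)"

definition list_instances :: "nat \<Rightarrow> list_instance set" where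
  "list_instances r =
     {(vs, G, L). pair_graph G \<and> distinct vs \<and> set vs = pverts G \<and> list_assignment r G L}"

fun encode :: "nat \<Rightarrow> list_instance \<Rightarrow> bool list" where
  "encode r (vs, G, L) =
     replicate (length vs) True @ [False] @
     map (\<lambda>(u, v). (u, v) \<in> parcs G) (List.product vs vs) @
     map (\<lambda>(u, c). c \<in> L u) (List.product vs [1..<Suc r])"

fun list_dr_colorable :: "nat \<Rightarrow> nat \<Rightarrow> list_instance \<Rightarrow> bool" where
  "list_dr_colorable d r (vs, G, L) \<longleftrightarrow>
     (\<exists>\<phi>. dr_coloring d r G \<phi> \<and> (\<forall>u \<in> pverts G. \<phi> u \<in> L u))"

end

theory Submission
  imports Defs
begin

text \<open>
  In a colourable graph the closed neighbourhoods have at most \<open>r\<close> vertices, because their elements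
  are pairwise at distance at most \<open>2 < d\<close>. A shortest path on \<open>4k - 1\<close> or more vertices contains an
  induced \<open>kP\<^sub>3\<close>, so in a \<open>kP\<^sub>3\<close>-free graph the components have radius at most \<open>4k\<close>. Hence in a
  colourable instance every component has at most \<open>r\<^bsup>4k\<^esup>\<close> vertices, a constant. Since the
  components can be coloured independently, colourability is expressed by a first-order sentence:
  every vertex lies in a neighbour-closed tuple of constant length that has a good colouring. A fixed
  first-order sentence is evaluated in polynomial time by nested loops over the vertices.
\<close>

section \<open>Components of colourable graphs\<close>

text \<open>Turns an embedding \<open>f\<close> that preserves and reflects arcs into an induced
  copy: \<open>F\<close> is induced on the image of \<open>f\<close>, and the inverse of
  \<open>f\<close> is the required isomorphism.\<close>

lemma not_induced_free:
  assumes G: "wf_digraph (with_proj G)"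
    and H: "parcs H \<subseteq> pverts H \<times> pverts H"
    and f: "inj_on f (pverts H)" "f ` pverts H \<subseteq> pverts G"
    and arcs: "\<And>x y. x \<in> pverts H \<Longrightarrow> y \<in> pverts H \<Longrightarrow> (f x, f y) \<in> parcs G \<longleftrightarrow> (x, y) \<in> parcs H"
  shows "\<not> induced_free H G"
proof -
  define F where "F = with_proj G \<restriction> (f ` pverts H)"
  define g where "g = inv_into (pverts H) f"
  have gf: "g (f x) = x" if "x \<in> pverts H" for x
    unfolding g_def using f(1) that by (rule inv_into_f_f)
  have F: "induced_subgraph F (with_proj G)"
    unfolding F_def using wf_digraph.induced_induce[OF G] f(2) by simp
  have arcs_F: "arcs F = map_prod f f ` parcs H"
    using arcs H by (force simp: F_def)
  have verts_F: "verts F = f ` pverts H"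
    by (simp add: F_def)
  let ?h = "\<lparr>iso_verts = g, iso_arcs = map_prod g g, iso_head = snd, iso_tail = fst\<rparr>"
  have "map_prod g g e = e'" if "e' \<in> parcs H" "e = map_prod f f e'" for e e'
    using that H gf by (cases e') auto
  then have img: "map_prod g g ` arcs F = parcs H"
    unfolding arcs_F by force
  have "digraph_iso F (with_proj H)"
    unfolding digraph_iso_def
  proof (intro exI conjI)
    have "inj_on g (f ` pverts H)"
      using gf by (auto intro!: inj_onI)
    moreover from this have "inj_on (map_prod g g) (f ` pverts H \<times> f ` pverts H)"
      by (intro map_prod_inj_on)
    then have "inj_on (map_prod g g) (arcs F)"
      by (rule inj_on_subset) (use H in \<open>auto simp: arcs_F\<close>)
    moreover have "wf_digraph F"
      using F by (auto simp: induced_subgraph_def subgraph_def)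
    ultimately show "pre_digraph.digraph_isomorphism F ?h"
      unfolding pre_digraph.digraph_isomorphism_def verts_F by (auto simp: F_def)
    show "with_proj H = app_iso ?h F"
      unfolding app_iso_def verts_F using img gf
      by (auto simp: with_proj_def image_image)
  qed
  with F show ?thesis
    by (auto simp: induced_free_def)
qed

text \<open>Under unit weights the cost of a walk is its length, and the infimum lies below
  \<open>Suc l\<close> iff some walk has at most \<open>l\<close> arcs. Such a walk is exactly
  \<open>l\<close> moves, each along an arc or staying put, whence the reflexive closure. The
  assumption on \<open>u\<close> rules out staying at a point outside the graph, where there is no
  walk.\<close>

lemma graph_dist_less_Suc_iff:
  assumes G: "wf_digraph (with_proj G)" and u: "u \<in> pverts G"
  shows "graph_dist G u v < ereal (real (Suc l)) \<longleftrightarrow> (u, v) \<in> ((parcs G)\<^sup>=) ^^ l"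
proof -
  interpret wf_digraph "with_proj G" by fact
  have cost: "awalk_cost (\<lambda>_. 1) p = real (length p)" for p :: "('a \<times> 'a) list"
    by (induction p) auto
  have "(\<exists>p. awalk u p v \<and> length p \<le> l) \<longleftrightarrow> (u, v) \<in> ((parcs G)\<^sup>=) ^^ l"
    using u
  proof (induction l arbitrary: u)
    case 0
    then show ?case by (auto simp: awalk_Nil_iff)
  next
    case (Suc l)
    show ?case
    proof
      assume "\<exists>p. awalk u p v \<and> length p \<le> Suc l"
      then obtain p where p: "awalk u p v" "length p \<le> Suc l" by blast
      show "(u, v) \<in> ((parcs G)\<^sup>=) ^^ Suc l"
      proof (cases p)
        case Nil
        with p(1) have "awalk v [] v" "u = v" by (auto simp: awalk_Nil_iff)
        then have "(u, v) \<in> ((parcs G)\<^sup>=) ^^ l"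
          using Suc.IH[OF Suc.prems] by (metis list.size(3) zero_le)
        with \<open>u = v\<close> show ?thesis by auto
      next
        case (Cons e p')
        with p have e: "e \<in> parcs G" "fst e = u" "awalk (snd e) p' v" "length p' \<le> l"
          by (auto simp: awalk_Cons_iff)
        then have "(snd e, v) \<in> ((parcs G)\<^sup>=) ^^ l"
          using Suc.IH[of "snd e"] head_in_verts[of e] by auto
        moreover have "(u, snd e) \<in> parcs G"
          using e by (metis prod.collapse)
        ultimately show ?thesis by (intro relpow_Suc_I2[of _ "snd e"]) auto
      qed
    next
      assume "(u, v) \<in> ((parcs G)\<^sup>=) ^^ Suc l"
      then obtain w where w: "(u, w) \<in> (parcs G)\<^sup>=" "(w, v) \<in> ((parcs G)\<^sup>=) ^^ l"
        by (metis relpow_Suc_D2)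
      have "w \<in> pverts G"
        using w(1) Suc.prems wellformed[of "(u, w)"] by auto
      then obtain p where p: "awalk w p v" "length p \<le> l"
        using Suc.IH[of w] w(2) by blast
      show "\<exists>p. awalk u p v \<and> length p \<le> Suc l"
      proof (cases "u = w")
        case False
        then have "awalk u ((u, w) # p) v"
          using p w by (auto simp: awalk_Cons_iff)
        with p(2) show ?thesis by (intro exI[of _ "(u, w) # p"]) auto
      qed (use p in force)
    qed
  qed
  then show ?thesis
    unfolding graph_dist_def \<mu>_def INF_less_iff cost by (auto simp: less_Suc_eq_le simp del: of_nat_Suc)
qed

lemma relpow_subset_reflcl_relpow:
  "i \<le> l \<Longrightarrow> R ^^ i \<subseteq> (R\<^sup>=) ^^ l"
proof (induction l arbitrary: i)
  case (Suc l)
  show ?case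
  proof (cases i)
    case 0
    then show ?thesis using Suc.IH[of 0] by auto
  next
    case (Suc j)
    then show ?thesis using Suc.IH[of j] Suc.prems by auto
  qed
qed auto

section \<open>Radius and size of components\<close>

definition component :: "'a pair_pre_digraph \<Rightarrow> 'a \<Rightarrow> 'a set" where
  "component G v = (parcs G)\<^sup>* `` {v}"

text \<open>A repeated vertex or a chord would be a shortcut: the first \<open>i\<close> steps, the
  chord if there is one, and the last \<open>m - j\<close> steps form a walk from \<open>u\<close>
  to \<open>v\<close>, so its length is at least \<open>m\<close>.\<close>

lemma shortest_relpow_induced:
  assumes "f 0 = u" "f m = v" and step: "\<And>i. i < m \<Longrightarrow> (f i, f (Suc i)) \<in> E"
    and min: "\<And>l. (u, v) \<in> E ^^ l \<Longrightarrow> m \<le> l"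
    and ij: "i < j" "j \<le> m"
  shows "f i \<noteq> f j" and "(f i, f j) \<in> E \<Longrightarrow> j = Suc i"
proof -
  have pre: "(u, f i) \<in> E ^^ i"
    unfolding relpow_fun_conv using assms by (intro exI[of _ f]) auto
  have suf: "(f j, v) \<in> E ^^ (m - j)"
    unfolding relpow_fun_conv using assms by (intro exI[of _ "\<lambda>l. f (j + l)"]) auto
  show "f i \<noteq> f j"
  proof
    assume "f i = f j"
    then have "(u, v) \<in> E ^^ (i + (m - j))"
      using pre suf by (auto simp: relpow_add)
    from min[OF this] show False using ij by simp
  qed
  assume "(f i, f j) \<in> E"
  then have "(f i, v) \<in> E ^^ Suc (m - j)"
    using suf by (rule relpow_Suc_I2)
  then have "(u, v) \<in> E ^^ (i + Suc (m - j))"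
    using pre unfolding relpow_add by blast
  from min[OF this] show "j = Suc i" using ij by simp
qed

text \<open>The copies of \<open>P\<^sub>3\<close> are what remains of a shortest path when every fourth vertex is deleted.\<close>

lemma component_radius:
  assumes G: "pair_graph G" and free: "induced_free (disjoint_copies k (path_graph 3)) G"
    and v: "v \<in> pverts G"
  shows "component G v \<subseteq> (((parcs G)\<^sup>=) ^^ (4 * k)) `` {v}"
proof
  interpret pair_graph G by fact
  have sym: "(x, y) \<in> parcs G \<Longrightarrow> (y, x) \<in> parcs G" for x y
    using arcs_symmetric by blast
  fix u assume "u \<in> component G v"
  then have "\<exists>l. (v, u) \<in> parcs G ^^ l"
    by (auto simp: component_def rtrancl_power)
  define m where "m = (LEAST l. (v, u) \<in> parcs G ^^ l)"
  have m: "(v, u) \<in> parcs G ^^ m" and min: "\<And>l. (v, u) \<in> parcs G ^^ l \<Longrightarrow> m \<le> l"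
    unfolding m_def using \<open>\<exists>l. _\<close> by (auto intro: LeastI_ex Least_le)
  have "m \<le> 4 * k"
  proof (rule ccontr)
    assume less: "\<not> m \<le> 4 * k"
    obtain f where f: "f 0 = v" "f m = u" "\<And>i. i < m \<Longrightarrow> (f i, f (Suc i)) \<in> parcs G"
      using m unfolding relpow_fun_conv by blast
    note short = shortest_relpow_induced[of f v m u "parcs G", OF f min]
    \<comment> \<open>Membership is read off the arc leaving \<open>f i\<close>, hence
      \<open>i < m\<close>. The largest position used below is \<open>4 * k - 2\<close>.\<close>
    have fV: "f i \<in> pverts G" if "i < m" for i
      using f(3)[OF that] by (auto dest: in_arcsD1)
    have inj: "f i = f j \<longleftrightarrow> i = j" if "i \<le> m" "j \<le> m" for i j
      using short(1)[of i j] short(1)[of j i] that by (metis linorder_neqE_nat)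
    have adj: "(f i, f j) \<in> parcs G \<longleftrightarrow> j = Suc i \<or> i = Suc j" if "i \<le> m" "j \<le> m" for i j
    proof
      assume a: "(f i, f j) \<in> parcs G"
      then have "i \<noteq> j" using no_loops' by auto
      then show "j = Suc i \<or> i = Suc j"
        using short(2)[of i j] short(2)[of j i] that a sym by (metis linorder_neqE_nat)
    qed (use f(3) sym that in auto)
    let ?H = "disjoint_copies k (path_graph 3)"
    have H: "pverts ?H = {..<k} \<times> {..<3}"
      "((i, a), (j, b)) \<in> parcs ?H \<longleftrightarrow> i < k \<and> i = j \<and> a < 3 \<and> b < 3 \<and> (b = Suc a \<or> a = Suc b)" for i a j b
      by (auto simp: disjoint_copies_def path_graph_def)
    define g where "g = (\<lambda>(i, a). f (4 * i + a))"
    have "\<not> induced_free ?H G"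
    proof (rule not_induced_free[where f = g])
      show "wf_digraph (with_proj G)" by unfold_locales
      show "parcs ?H \<subseteq> pverts ?H \<times> pverts ?H"
        using H by auto
      show "inj_on g (pverts ?H)"
      proof (rule inj_onI)
        fix x y assume xy: "x \<in> pverts ?H" "y \<in> pverts ?H" "g x = g y"
        obtain i a j b where "x = (i, a)" "y = (j, b)" by fastforce
        with xy have ij: "i < k" "j < k" "a < 3" "b < 3" "x = (i, a)" "y = (j, b)"
          by (auto simp: H(1))
        with xy(3) less have "4 * i + a = 4 * j + b"
          by (simp add: g_def inj)
        with ij(3,4) have "i = j \<and> a = b" by presburger
        with ij show "x = y" by simp
      qed
      show "g ` pverts ?H \<subseteq> pverts G"
        using less by (auto simp: H g_def intro!: fV)
      fix x y assume xy: "x \<in> pverts ?H" "y \<in> pverts ?H"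
      obtain i a j b where "x = (i, a)" "y = (j, b)" by fastforce
      with xy have ij: "i < k" "j < k" "a < 3" "b < 3" "x = (i, a)" "y = (j, b)"
        by (auto simp: H(1))
      then have "(g x, g y) \<in> parcs G \<longleftrightarrow> 4 * j + b = Suc (4 * i + a) \<or> 4 * i + a = Suc (4 * j + b)"
        using less by (simp add: g_def adj)
      also have "\<dots> \<longleftrightarrow> i = j \<and> (b = Suc a \<or> a = Suc b)"
        using ij(3,4) by presburger
      finally show "(g x, g y) \<in> parcs G \<longleftrightarrow> (x, y) \<in> parcs ?H"
        using ij by (simp add: H(2))
    qed
    with free show False by simp
  qed
  with m show "u \<in> (((parcs G)\<^sup>=) ^^ (4 * k)) `` {v}"
    using relpow_subset_reflcl_relpow by blast
qed

text \<open>One more step replaces each of the at most \<open>r ^ l\<close> points reached so far by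
  at most \<open>r\<close> points.\<close>

lemma card_relpow_Image:
  fixes R :: "'a rel"
  assumes "\<And>x. finite (R `` {x})" "\<And>x. card (R `` {x}) \<le> r"
  shows "finite ((R ^^ l) `` {v}) \<and> card ((R ^^ l) `` {v}) \<le> r ^ l"
proof (induction l)
  case (Suc l)
  have eq: "(R ^^ Suc l) `` {v} = (\<Union>x\<in>(R ^^ l) `` {v}. R `` {x})"
    by auto
  have "card ((R ^^ Suc l) `` {v}) \<le> (\<Sum>x\<in>(R ^^ l) `` {v}. card (R `` {x}))"
    unfolding eq using Suc by (intro card_UN_le) auto
  also have "\<dots> \<le> card ((R ^^ l) `` {v}) * r"
    using assms(2) by (metis sum_bounded_above of_nat_id)
  also have "\<dots> \<le> r ^ l * r"
    using Suc by simp
  finally have "card ((R ^^ Suc l) `` {v}) \<le> r ^ Suc l"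
    by (simp add: mult.commute)
  moreover have "finite ((R ^^ Suc l) `` {v})"
    unfolding eq using Suc assms(1) by (intro finite_UN_I) auto
  ultimately show ?case by simp
qed auto

lemma dr_coloring_relpow:
  assumes "wf_digraph (with_proj G)"
  shows "dr_coloring (Suc l) r G \<phi> \<longleftrightarrow> (\<forall>u\<in>pverts G. \<phi> u \<in> {1..r}) \<and>
    (\<forall>u\<in>pverts G. \<forall>v\<in>pverts G. u \<noteq> v \<and> (u, v) \<in> ((parcs G)\<^sup>=) ^^ l \<longrightarrow> \<phi> u \<noteq> \<phi> v)"
  unfolding dr_coloring_def using graph_dist_less_Suc_iff[OF assms] by auto

text \<open>The colouring is injective on closed neighbourhoods, which bounds them by
  \<open>r\<close>; iterating this bound up to the radius \<open>4 * k\<close> covers the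
  component.\<close>

lemma card_component_le:
  assumes G: "pair_graph G" and free: "induced_free (disjoint_copies k (path_graph 3)) G"
    and \<phi>: "dr_coloring (Suc l) r G \<phi>" and l: "2 \<le> l" and v: "v \<in> pverts G" and r: "1 \<le> r"
  shows "finite (component G v)" "card (component G v) \<le> r ^ (4 * k)"
proof -
  interpret pair_graph G by fact
  have wf: "wf_digraph (with_proj G)" by unfold_locales
  let ?R = "(parcs G)\<^sup>="
  have col: "\<forall>u\<in>pverts G. \<phi> u \<in> {1..r}"
    "\<And>u v. u \<in> pverts G \<Longrightarrow> v \<in> pverts G \<Longrightarrow> u \<noteq> v \<Longrightarrow> (u, v) \<in> ?R ^^ l \<Longrightarrow> \<phi> u \<noteq> \<phi> v"
    using \<phi> unfolding dr_coloring_relpow[OF wf] by auto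
  \<comment> \<open>Two members of the closed neighbourhood of \<open>x\<close> are joined by two
    moves through \<open>x\<close>, and \<open>2 \<le> l\<close>.\<close>
  have near: "(a, b) \<in> ?R ^^ l" if "(x, a) \<in> ?R" "(x, b) \<in> ?R" for a b x
  proof -
    have "(a, x) \<in> ?R" using that(1) arcs_symmetric by auto
    then have "(a, b) \<in> ?R ^^ 2"
      using that(2) by (auto simp: numeral_2_eq_2)
    then show ?thesis
      using relpow_subset_reflcl_relpow[OF l, of ?R] by auto
  qed
  have "finite (?R `` {x}) \<and> card (?R `` {x}) \<le> r" for x
  proof (cases "x \<in> pverts G")
    case True
    then have sub: "?R `` {x} \<subseteq> pverts G"
      by (auto dest: in_arcsD2)
    have "card (?R `` {x}) \<le> card {1..r}"
    proof (rule card_inj_on_le[of \<phi>])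
      show "inj_on \<phi> (?R `` {x})"
        using col(2) near sub by (intro inj_onI) blast
    qed (use sub col(1) in auto)
    moreover have "finite (?R `` {x})"
      using sub pair_finite_verts by (rule finite_subset)
    ultimately show ?thesis by simp
  next
    \<comment> \<open>The counting lemma asks for the bound at every point of the type; outside the
      graph only staying put is possible, and \<open>1 \<le> r\<close> covers that.\<close>
    case False
    then have "?R `` {x} = {x}"
      by (auto dest: in_arcsD1)
    with r show ?thesis by simp
  qed
  then have *: "finite ((?R ^^ (4 * k)) `` {v}) \<and> card ((?R ^^ (4 * k)) `` {v}) \<le> r ^ (4 * k)"
    by (intro card_relpow_Image) auto
  note sub = component_radius[OF G free v]
  show "finite (component G v)"
    using sub * finite_subset by blast
  show "card (component G v) \<le> r ^ (4 * k)"
    using card_mono[OF _ sub] * by linarith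
qed

section \<open>Colourability as a condition on bounded vertex sets\<close>

text \<open>Distances are measured in all of \<open>G\<close>, not inside \<open>X\<close>. The
  condition passes to subsets of \<open>X\<close>.\<close>

definition locally_colourable :: "nat \<Rightarrow> 'a pair_pre_digraph \<Rightarrow> ('a \<Rightarrow> nat set) \<Rightarrow> 'a set \<Rightarrow> bool" where
  "locally_colourable l G L X \<longleftrightarrow> (\<exists>\<phi>. \<forall>u\<in>X. \<phi> u \<in> L u \<and>
     (\<forall>v\<in>X. (u, v) \<in> ((parcs G)\<^sup>=) ^^ l \<and> u \<noteq> v \<longrightarrow> \<phi> u \<noteq> \<phi> v))"

lemma relpow_reflcl_in_component:
  assumes "(u, v) \<in> ((parcs G)\<^sup>=) ^^ l"
  shows "v \<in> component G u"
  using relpow_imp_rtrancl[OF assms] by (simp add: component_def)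

text \<open>Forwards, \<open>ys\<close> lists the component of \<open>v\<close>. Backwards, a closed
  set containing \<open>v\<close> includes its component, so every component has a good colouring.
  These glue together, because \<open>l\<close> moves never leave a component and so impose nothing
  across components.\<close>

lemma list_dr_colorable_iff_local:
  assumes I: "(vs, G, L) \<in> list_instances r"
    and free: "induced_free (disjoint_copies k (path_graph 3)) G"
    and l: "2 \<le> l" and r: "1 \<le> r"
  shows "list_dr_colorable (Suc l) r (vs, G, L) \<longleftrightarrow>
    (\<forall>v\<in>pverts G. \<exists>ys. length ys = r ^ (4 * k) \<and> set ys \<subseteq> pverts G \<and>
       parcs G `` set (v # ys) \<subseteq> set (v # ys) \<and> locally_colourable l G L (set (v # ys)))"
    (is "_ \<longleftrightarrow> ?rhs")
proof -
  have G: "pair_graph G" and L: "\<And>u. u \<in> pverts G \<Longrightarrow> L u \<subseteq> {1..r}"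
    using I by (auto simp: list_instances_def list_assignment_def)
  interpret pair_graph G by fact
  have wf: "wf_digraph (with_proj G)" by unfold_locales
  have comp_V: "component G v \<subseteq> pverts G" if "v \<in> pverts G" for v
  proof
    fix u assume "u \<in> component G v"
    then have "(v, u) \<in> (parcs G)\<^sup>*" by (simp add: component_def)
    then show "u \<in> pverts G"
      by induction (use that in_arcsD2 in auto)
  qed
  show ?thesis
  proof
    assume "list_dr_colorable (Suc l) r (vs, G, L)"
    then obtain \<phi> where \<phi>: "dr_coloring (Suc l) r G \<phi>" "\<forall>u\<in>pverts G. \<phi> u \<in> L u"
      by auto
    show ?rhs
    proof
      fix v assume v: "v \<in> pverts G"
      note comp = card_component_le[OF G free \<phi>(1) l v r]
      obtain zs where zs: "set zs = component G v" "length zs = card (component G v)"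
        using finite_distinct_list[OF comp(1)] distinct_card by metis
      \<comment> \<open>The length must be the same for all \<open>v\<close>, so the list is padded
        with copies of \<open>v\<close>, which already belongs to the component.\<close>
      define ys where "ys = zs @ replicate (r ^ (4 * k) - length zs) v"
      have vc: "v \<in> component G v" by (simp add: component_def)
      have ys: "set ys = component G v" "set (v # ys) = component G v"
        unfolding ys_def set_append list.set zs(1) set_replicate_conv_if using vc by auto
      have "parcs G `` component G v \<subseteq> component G v"
        by (auto simp: component_def)
      moreover have "length ys = r ^ (4 * k)"
        using comp zs by (simp add: ys_def)
      moreover have "locally_colourable l G L (component G v)"
        unfolding locally_colourable_def
        using \<phi> comp_V[OF v] unfolding dr_coloring_relpow[OF wf] by blast
      ultimately show "\<exists>ys. length ys = r ^ (4 * k) \<and> set ys \<subseteq> pverts G \<and>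
          parcs G `` set (v # ys) \<subseteq> set (v # ys) \<and> locally_colourable l G L (set (v # ys))"
        using comp_V[OF v] ys by metis
    qed
  next
    assume rhs: ?rhs
    have "\<forall>v\<in>pverts G. \<exists>\<phi>. \<forall>u\<in>component G v. \<phi> u \<in> L u \<and>
        (\<forall>w\<in>component G v. (u, w) \<in> ((parcs G)\<^sup>=) ^^ l \<and> u \<noteq> w \<longrightarrow> \<phi> u \<noteq> \<phi> w)"
    proof
      fix v assume v: "v \<in> pverts G"
      with rhs obtain ys where ys: "parcs G `` set (v # ys) \<subseteq> set (v # ys)"
        "locally_colourable l G L (set (v # ys))" by blast
      have "component G v \<subseteq> set (v # ys)"
      proof
        fix u assume "u \<in> component G v"
        then have "(v, u) \<in> (parcs G)\<^sup>*" by (simp add: component_def)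
        then show "u \<in> set (v # ys)"
          by induction (use ys(1) in auto)
      qed
      with ys(2) show "\<exists>\<phi>. \<forall>u\<in>component G v. \<phi> u \<in> L u \<and>
        (\<forall>w\<in>component G v. (u, w) \<in> ((parcs G)\<^sup>=) ^^ l \<and> u \<noteq> w \<longrightarrow> \<phi> u \<noteq> \<phi> w)"
        unfolding locally_colourable_def by (meson subsetD)
    qed
    from bchoice[OF this] obtain \<chi> where \<chi>: "\<And>v u. v \<in> pverts G \<Longrightarrow> u \<in> component G v \<Longrightarrow> \<chi> v u \<in> L u"
      "\<And>v u w. v \<in> pverts G \<Longrightarrow> u \<in> component G v \<Longrightarrow> w \<in> component G v \<Longrightarrow>
        (u, w) \<in> ((parcs G)\<^sup>=) ^^ l \<Longrightarrow> u \<noteq> w \<Longrightarrow> \<chi> v u \<noteq> \<chi> v w"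
      by blast
    \<comment> \<open>The colourings \<open>\<chi> v\<close> of one component may differ for its
      different vertices \<open>v\<close>. A common representative makes the whole component use a
      single one.\<close>
    define rep where "rep v = (SOME u. u \<in> component G v)" for v
    have "sym (parcs G)"
      using arcs_symmetric by (auto intro: symI)
    then have sym: "(x, y) \<in> (parcs G)\<^sup>* \<Longrightarrow> (y, x) \<in> (parcs G)\<^sup>*" for x y
      by (metis sym_rtrancl symD)
    have rep: "rep v \<in> component G v" "v \<in> component G (rep v)" for v
    proof -
      show "rep v \<in> component G v"
        unfolding rep_def by (rule someI[of _ v]) (simp add: component_def)
      then show "v \<in> component G (rep v)"
        using sym by (simp add: component_def)
    qed
    have rep_eq: "rep u = rep v" if "v \<in> component G u" for u v
    proof -
      have "component G u = component G v"
        using that sym by (auto simp: component_def intro: rtrancl_trans)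
      then show ?thesis by (simp add: rep_def)
    qed
    define \<phi> where "\<phi> v = \<chi> (rep v) v" for v
    have \<phi>L: "\<phi> v \<in> L v" if "v \<in> pverts G" for v
      unfolding \<phi>_def using \<chi>(1)[of "rep v" v] rep comp_V that by blast
    have "\<phi> u \<noteq> \<phi> v" 
      if "u \<in> pverts G" "v \<in> pverts G" "u \<noteq> v" "(u, v) \<in> ((parcs G)\<^sup>=) ^^ l" for u v
    proof -
      have "rep u = rep v"
        using that(4) by (intro rep_eq relpow_reflcl_in_component)
      then show ?thesis
        unfolding \<phi>_def using \<chi>(2)[of "rep v" u v] rep comp_V that by (metis subsetD)
    qed
    with \<phi>L L have "dr_coloring (Suc l) r G \<phi>"
      unfolding dr_coloring_relpow[OF wf] by blast
    with \<phi>L show "list_dr_colorable (Suc l) r (vs, G, L)"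
      by auto
  qed
qed

section \<open>Running programs\<close>

text \<open>A total-correctness triple in which \<open>T\<close> only bounds the time from above, so
  that bounds can be added and weakened.\<close>

definition runs :: "bool list \<Rightarrow> com \<Rightarrow> state \<Rightarrow> nat \<Rightarrow> (state \<Rightarrow> bool) \<Rightarrow> bool" where
  "runs w c s T Q \<longleftrightarrow> (\<exists>t s'. exec w c s t s' \<and> t \<le> T \<and> Q s')"

lemma runs_mono: "runs w c s T Q \<Longrightarrow> T \<le> T' \<Longrightarrow> (\<And>s'. Q s' \<Longrightarrow> Q' s') \<Longrightarrow> runs w c s T' Q'"
  unfolding runs_def by (meson order_trans)

lemma runs_basic:
  "Q (s(a := n)) \<Longrightarrow> 0 < T \<Longrightarrow> runs w (Const a n) s T Q"
  "Q (s(a := s b + s c)) \<Longrightarrow> 0 < T \<Longrightarrow> runs w (Add a b c) s T Q"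
  "Q (s(a := s b - s c)) \<Longrightarrow> 0 < T \<Longrightarrow> runs w (Sub a b c) s T Q"
  "Q (s(a := input_at w (s b))) \<Longrightarrow> 0 < T \<Longrightarrow> runs w (Read a b) s T Q"
  unfolding runs_def by (metis exec.Const exec.Add exec.Sub exec.Read less_eq_Suc_le One_nat_def)+

text \<open>Rules for symbolic execution: a straight-line program reduces to a claim about its final
  state.\<close>

lemma runs_Seq_basic:
  "runs w q (s(a := n)) T Q \<Longrightarrow> runs w (Seq (Const a n) q) s (Suc T) Q"
  "runs w q (s(a := s b + s c)) T Q \<Longrightarrow> runs w (Seq (Add a b c) q) s (Suc T) Q"
  "runs w q (s(a := s b - s c)) T Q \<Longrightarrow> runs w (Seq (Sub a b c) q) s (Suc T) Q"
  "runs w q (s(a := input_at w (s b))) T Q \<Longrightarrow> runs w (Seq (Read a b) q) s (Suc T) Q"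
  unfolding runs_def
  by (metis exec.Seq exec.Const exec.Add exec.Sub exec.Read Suc_le_mono plus_1_eq_Suc)+

lemma runs_Seq:
  assumes "runs w p s T R" and "\<And>s'. R s' \<Longrightarrow> runs w q s' T' Q"
  shows "runs w (Seq p q) s (T + T') Q"
proof -
  obtain t s' where 1: "exec w p s t s'" "t \<le> T" "R s'"
    using assms(1) unfolding runs_def by blast
  then obtain t' s'' where "exec w q s' t' s''" "t' \<le> T'" "Q s''"
    using assms(2) unfolding runs_def by blast
  with 1 show ?thesis
    unfolding runs_def by (meson exec.Seq add_mono)
qed

lemma runs_Cond:
  assumes "s a \<noteq> 0 \<Longrightarrow> runs w p s T Q" and "s a = 0 \<Longrightarrow> runs w q s T Q"
  shows "runs w (Cond a p q) s (Suc T) Q"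
proof (cases "s a = 0")
  case True
  with assms(2) obtain t s' where "exec w q s t s'" "t \<le> T" "Q s'"
    unfolding runs_def by blast
  with True show ?thesis
    unfolding runs_def by (meson exec.CondFalse Suc_le_mono)
next
  case False
  with assms(1) obtain t s' where "exec w p s t s'" "t \<le> T" "Q s'"
    unfolding runs_def by blast
  with False show ?thesis
    unfolding runs_def by (meson exec.CondTrue Suc_le_mono)
qed

text \<open>The index of the invariant is also the variant: there are at most \<open>m\<close>
  rounds of cost \<open>T\<close> plus one test, and a last failing test. Any smaller
  \<open>m'\<close> is allowed after a round, so a loop may jump to its end.\<close>

lemma runs_While:
  assumes "I m s"
    and body: "\<And>m s. I m s \<Longrightarrow> s a \<noteq> 0 \<Longrightarrow> runs w p s T (\<lambda>s'. \<exists>m'<m. I m' s')"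
  shows "runs w (While a p) s (Suc (m * Suc T)) (\<lambda>s'. s' a = 0 \<and> (\<exists>m'. I m' s'))"
  using assms(1)
proof (induction m arbitrary: s rule: less_induct)
  case (less m)
  show ?case
  proof (cases "s a = 0")
    case True
    then show ?thesis
      unfolding runs_def using exec.WhileFalse[of s a w p] less.prems by fastforce
  next
    case False
    then obtain t s' m' where 1: "exec w p s t s'" "t \<le> T" "m' < m" "I m' s'"
      using body[OF less.prems] unfolding runs_def by blast
    then obtain t' s'' where 2: "exec w (While a p) s' t' s''" "t' \<le> Suc (m' * Suc T)"
        "s'' a = 0 \<and> (\<exists>m'. I m' s'')"
      using less.IH unfolding runs_def by blast
    have "Suc m' * Suc T \<le> m * Suc T"
      using \<open>m' < m\<close> by (intro mult_right_mono) auto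
    then have "Suc (t + t') \<le> Suc (m * Suc T)"
      using 1(2) 2(2) by simp
    then show ?thesis
      using exec.WhileTrue[OF False 1(1) 2(1)] 2(3) unfolding runs_def by blast
  qed
qed

text \<open>The last argument of \<open>Sub\<close> is a register, which has to hold the number 1.\<close>

definition add_times :: "nat \<Rightarrow> nat \<Rightarrow> nat \<Rightarrow> com" where
  "add_times a b c = While c (Seq (Add a a b) (Sub c c 1))"

text \<open>Multiplication by repeated addition. A round costs one test and two commands, hence the
  factor 3; the counter \<open>c\<close> is consumed.\<close>

lemma runs_add_times:
  assumes "s 1 = 1" and "distinct [a, b, c, 1]"
    and "Q (s(a := s a + s c * s b, c := 0))"
  shows "runs w (add_times a b c) s (Suc (s c * 3)) Q"
proof -
  define I where "I m s' \<longleftrightarrow> s' = s(a := s a + (s c - m) * s b, c := m) \<and> m \<le> s c" for m s'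
  have "runs w (add_times a b c) s (Suc (s c * Suc (Suc (Suc 0))))
      (\<lambda>s'. s' c = 0 \<and> (\<exists>m'. I m' s'))"
    unfolding add_times_def
  proof (rule runs_While[where I = I])
    show "I (s c) s"
      by (auto simp: I_def)
  next
    fix m s'
    assume I: "I m s'" and "s' c \<noteq> 0"
    then have m: "0 < m" "m \<le> s c"
      by (auto simp: I_def)
    then have "s c - (m - 1) = Suc (s c - m)"
      by simp
    then have *: "I (m - 1) (s'(a := s' a + s' b, c := s' c - s' 1))"
      using I assms(1,2) by (auto simp: I_def fun_eq_iff)
    have "(s'(a := s' a + s' b)) c - (s'(a := s' a + s' b)) 1 = s' c - s' 1"
      using assms(2) by auto
    then show "runs w (Seq (Add a a b) (Sub c c 1)) s' (Suc (Suc 0)) (\<lambda>s'. \<exists>m'<m. I m' s')"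
      using * m(1) by (intro runs_Seq_basic runs_basic exI[of _ "m - 1"]) simp_all
  qed
  then show ?thesis
    by (rule runs_mono) (use assms(2,3) in \<open>auto simp: I_def\<close>)
qed

lemma runs_Seq_add_times:
  assumes "runs w q (s(a := s a + n * s b, c := 0)) T Q" and "s c = n" and "s 1 = 1"
    and "distinct [a, b, c, 1]"
  shows "runs w (Seq (add_times a b c) q) s (Suc (n * 3) + T) Q"
  unfolding assms(2)[symmetric]
  by (rule runs_Seq[where R = "\<lambda>s'. s' = s(a := s a + n * s b, c := 0)"])
    (use assms in \<open>auto intro: runs_add_times\<close>)

declare encode.simps [simp del]

lemma length_vs_le: "length vs \<le> length (encode r (vs, G, L))"
  by (simp add: encode.simps)

section \<open>First-order properties\<close>

text \<open>
  The values \<open>xs\<close> of the free variables are kept in registers 6, 7, \<open>\<dots>\<close> as positions in \<open>vs\<close>.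
  Registers 3, 4 and 5 are scratch, and register 0 receives the truth value.
\<close>

definition env :: "nat list \<Rightarrow> nat list \<Rightarrow> state \<Rightarrow> bool" where
  "env vs xs s \<longleftrightarrow> s 1 = 1 \<and> s 2 = length vs \<and>
     (\<forall>i<length xs. s (6 + i) < length vs \<and> vs ! s (6 + i) = xs ! i)"

lemma env_upd: "env vs xs s \<Longrightarrow> a \<in> {0, 3, 4, 5} \<or> 6 + length xs \<le> a \<Longrightarrow> env vs xs (s(a := x))"
  unfolding env_def by auto

lemma env_snoc:
  "env vs (xs @ [v]) s \<longleftrightarrow>
     env vs xs s \<and> s (6 + length xs) < length vs \<and> vs ! s (6 + length xs) = v"
  unfolding env_def by (auto simp: nth_append less_Suc_eq)

type_synonym vertex_prop = "nat pair_pre_digraph \<Rightarrow> (nat \<Rightarrow> nat set) \<Rightarrow> nat list \<Rightarrow> bool"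

text \<open>The environment has to hold again on exit, so that programs for subformulas can run one
  after another. Registers beyond the variables may be overwritten.\<close>

definition decides :: "nat \<Rightarrow> nat \<Rightarrow> vertex_prop \<Rightarrow> com \<Rightarrow> nat poly \<Rightarrow> bool" where
  "decides r m P c p \<longleftrightarrow>
     (\<forall>vs G L xs s. (vs, G, L) \<in> list_instances r \<and> length xs = m \<and> env vs xs s \<longrightarrow>
        runs (encode r (vs, G, L)) c s (poly p (length (encode r (vs, G, L))))
          (\<lambda>s'. env vs xs s' \<and> (s' 0 \<noteq> 0 \<longleftrightarrow> P G L xs)))"

definition decidable :: "nat \<Rightarrow> nat \<Rightarrow> vertex_prop \<Rightarrow> bool" where
  "decidable r m P \<longleftrightarrow> (\<exists>c p. decides r m P c p)"

lemma decidableI: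
  assumes "\<And>vs G L xs s. (vs, G, L) \<in> list_instances r \<Longrightarrow> length xs = m \<Longrightarrow> env vs xs s \<Longrightarrow>
     runs (encode r (vs, G, L)) c s (poly p (length (encode r (vs, G, L))))
          (\<lambda>s'. env vs xs s' \<and> (s' 0 \<noteq> 0 \<longleftrightarrow> P G L xs))"
  shows "decidable r m P"
  unfolding decidable_def decides_def using assms by blast

text \<open>Equivalence is required only on tuples of vertices of genuine instances:
  \<open>env\<close> makes every entry of \<open>xs\<close> an entry of \<open>vs\<close>, hence a
  vertex.\<close>

lemma decidable_cong:
  assumes "decidable r m P"
    and "\<And>vs G L xs. (vs, G, L) \<in> list_instances r \<Longrightarrow> length xs = m \<Longrightarrow> set xs \<subseteq> pverts G \<Longrightarrow>
      P G L xs = Q G L xs"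
  shows "decidable r m Q"
proof -
  have PQ: "P G L xs = Q G L xs"
    if "(vs, G, L) \<in> list_instances r" "length xs = m" "env vs xs s" for vs G L xs s
  proof (rule assms(2)[OF that(1,2)])
    show "set xs \<subseteq> pverts G"
      using that by (force simp: list_instances_def env_def in_set_conv_nth)
  qed
  obtain c p where c: "decides r m P c p"
    using assms(1) by (auto simp: decidable_def)
  have "decides r m Q c p"
    unfolding decides_def
  proof (intro allI impI, elim conjE)
    fix vs G L xs s
    assume *: "(vs, G, L) \<in> list_instances r" "length xs = m" "env vs xs s"
    then show "runs (encode r (vs, G, L)) c s (poly p (length (encode r (vs, G, L))))
        (\<lambda>s'. env vs xs s' \<and> (s' 0 \<noteq> 0 \<longleftrightarrow> Q G L xs))"
      using c unfolding decides_def PQ[OF *, symmetric] by blast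
  qed
  then show ?thesis
    by (auto simp: decidable_def)
qed

lemma decidable_const: "decidable r m (\<lambda>G L xs. b)"
  by (rule decidableI[of _ _ "Const 0 (of_bool b)" 1])
    (auto intro!: runs_basic simp: env_upd)

lemma decidable_not:
  assumes "decidable r m P"
  shows "decidable r m (\<lambda>G L xs. \<not> P G L xs)"
proof -
  obtain c p where c: "decides r m P c p"
    using assms by (auto simp: decidable_def)
  show ?thesis
  proof (rule decidableI[of _ _ "Seq c (Cond 0 (Const 0 0) (Const 0 1))" "p + 2"])
    fix vs G L xs s
    assume *: "(vs, G, L) \<in> list_instances r" "length xs = m" "env vs xs s"
    let ?w = "encode r (vs, G, L)"
    have 1: "runs ?w c s (poly p (length ?w)) (\<lambda>s'. env vs xs s' \<and> (s' 0 \<noteq> 0 \<longleftrightarrow> P G L xs))"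
      using c * unfolding decides_def by blast
    have "runs ?w (Seq c (Cond 0 (Const 0 0) (Const 0 1))) s (poly p (length ?w) + Suc 1)
        (\<lambda>s'. env vs xs s' \<and> (s' 0 \<noteq> 0 \<longleftrightarrow> \<not> P G L xs))"
      by (rule runs_Seq[OF 1], rule runs_Cond) (auto intro!: runs_basic simp: env_upd)
    then show "runs ?w (Seq c (Cond 0 (Const 0 0) (Const 0 1))) s (poly (p + 2) (length ?w))
        (\<lambda>s'. env vs xs s' \<and> (s' 0 \<noteq> 0 \<longleftrightarrow> \<not> P G L xs))"
      by (rule runs_mono) auto
  qed
qed

lemma decidable_and:
  assumes "decidable r m P" and "decidable r m Q"
  shows "decidable r m (\<lambda>G L xs. P G L xs \<and> Q G L xs)"
proof -
  obtain c p c' p' where c: "decides r m P c p" and c': "decides r m Q c' p'"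
    using assms by (auto simp: decidable_def)
  show ?thesis
  proof (rule decidableI[of _ _ "Seq c (Cond 0 c' (Const 0 0))" "p + (p' + 2)"])
    fix vs G L xs s
    assume *: "(vs, G, L) \<in> list_instances r" "length xs = m" "env vs xs s"
    let ?w = "encode r (vs, G, L)"
    have 1: "runs ?w c s (poly p (length ?w)) (\<lambda>s'. env vs xs s' \<and> (s' 0 \<noteq> 0 \<longleftrightarrow> P G L xs))"
      using c * unfolding decides_def by blast
    have 2: "runs ?w c' s (Suc (poly p' (length ?w))) (\<lambda>s'. env vs xs s' \<and> (s' 0 \<noteq> 0 \<longleftrightarrow> Q G L xs))"
      if "env vs xs s" for s
      by (rule runs_mono[where T = "poly p' (length ?w)"])
        (use c' *(1,2) that in \<open>auto simp: decides_def\<close>)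
    have "runs ?w (Seq c (Cond 0 c' (Const 0 0))) s (poly p (length ?w) + Suc (Suc (poly p' (length ?w))))
        (\<lambda>s'. env vs xs s' \<and> (s' 0 \<noteq> 0 \<longleftrightarrow> P G L xs \<and> Q G L xs))"
      using 2 by (intro runs_Seq[OF 1] runs_Cond runs_basic)
        (auto simp: env_upd)
    then show "runs ?w (Seq c (Cond 0 c' (Const 0 0))) s (poly (p + (p' + 2)) (length ?w))
        (\<lambda>s'. env vs xs s' \<and> (s' 0 \<noteq> 0 \<longleftrightarrow> P G L xs \<and> Q G L xs))"
      by (rule runs_mono) auto
  qed
qed

text \<open>The new variable occupies register \<open>6 + m\<close> and counts down through the
  positions of \<open>vs\<close>. Register 0 tells whether a witness was found, and a witness resets
  the counter to end the search.\<close>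

lemma decidable_ex:
  assumes "decidable r (Suc m) P"
  shows "decidable r m (\<lambda>G L xs. \<exists>v\<in>pverts G. P G L (xs @ [v]))"
proof -
  obtain c p where c: "decides r (Suc m) P c p"
    using assms by (auto simp: decidable_def)
  define x where "x = 6 + m"
  define body where "body = Seq (Sub x x 1) (Seq c (Cond 0 (Const x 0) (Const 0 0)))"
  show ?thesis
  \<comment> \<open>Clearing register 0 also supplies the zero operand with which
    \<open>Add x 2 0\<close> copies the vertex count. In the bound, \<open>[:0, 1:]\<close> is the
    polynomial variable, and a round costs 4 steps besides \<open>c\<close>.\<close>
  proof (rule decidableI[of _ _ "Seq (Const 0 0) (Seq (Add x 2 0) (While x body))"
        "2 + (1 + [:0, 1:] * (p + 4))"])
    fix vs G L xs s
    assume *: "(vs, G, L) \<in> list_instances r" "length xs = m" "env vs xs s"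
    let ?w = "encode r (vs, G, L)"
    let ?n = "length vs"
    let ?T = "poly p (length ?w)"
    have V: "pverts G = set vs" and dist: "distinct vs"
      using * by (auto simp: list_instances_def)
    have c1: "runs ?w c s ?T (\<lambda>s'. env vs (xs @ [v]) s' \<and> (s' 0 \<noteq> 0 \<longleftrightarrow> P G L (xs @ [v])))"
      if "env vs (xs @ [v]) s" for s v
      using c *(1,2) that unfolding decides_def by simp
    \<comment> \<open>Positions from \<open>j\<close> upwards have been refuted, unless a witness is
      known and the counter is 0.\<close>
    define I where "I j s \<longleftrightarrow> env vs xs s \<and> j \<le> ?n \<and> s x = j \<and>
        (if s 0 = 0 then \<forall>a. j \<le> a \<and> a < ?n \<longrightarrow> \<not> P G L (xs @ [vs ! a])
         else j = 0 \<and> (\<exists>v\<in>pverts G. P G L (xs @ [v])))" for j s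
    have "runs ?w (Seq (Const 0 0) (Seq (Add x 2 0) (While x body))) s
        (1 + (1 + Suc (?n * Suc (1 + (?T + Suc 1)))))
        (\<lambda>s'. env vs xs s' \<and> (s' 0 \<noteq> 0 \<longleftrightarrow> (\<exists>v\<in>pverts G. P G L (xs @ [v]))))"
    proof (rule runs_Seq[where R = "\<lambda>s'. env vs xs s' \<and> s' 0 = 0"])
      show "runs ?w (Const 0 0) s 1 (\<lambda>s'. env vs xs s' \<and> s' 0 = 0)"
        using * by (intro runs_basic) (auto simp: env_upd)
      fix s assume s: "env vs xs s \<and> s 0 = 0"
      show "runs ?w (Seq (Add x 2 0) (While x body)) s (1 + Suc (?n * Suc (1 + (?T + Suc 1))))
        (\<lambda>s'. env vs xs s' \<and> (s' 0 \<noteq> 0 \<longleftrightarrow> (\<exists>v\<in>pverts G. P G L (xs @ [v]))))"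
      proof (rule runs_Seq[where R = "I ?n"])
        show "runs ?w (Add x 2 0) s 1 (I ?n)"
          using s *(2) by (intro runs_basic) (auto simp: I_def x_def env_upd, auto simp: env_def)
        fix s assume "I ?n s"
        then have "runs ?w (While x body) s (Suc (?n * Suc (1 + (?T + Suc 1))))
            (\<lambda>s'. s' x = 0 \<and> (\<exists>j. I j s'))"
        proof (rule runs_While[where I = I])
          fix j s
          assume I: "I j s" and sx: "s x \<noteq> 0"
          then have j: "0 < j" "j \<le> ?n" "s x = j" "env vs xs s"
            and nP: "\<And>a. j \<le> a \<and> a < ?n \<Longrightarrow> \<not> P G L (xs @ [vs ! a])"
            by (auto simp: I_def split: if_splits)
          let ?v = "vs ! (j - 1)"
          have v: "?v \<in> pverts G"
            using j V by auto
          show "runs ?w body s (1 + (?T + Suc 1)) (\<lambda>s'. \<exists>j'<j. I j' s')"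
            unfolding body_def
          proof (rule runs_Seq[where R = "\<lambda>s'. s' x = j - 1 \<and> env vs xs s'"])
            show "runs ?w (Sub x x 1) s 1 (\<lambda>s'. s' x = j - 1 \<and> env vs xs s')"
              using j *(2) by (intro runs_basic) (auto simp: x_def env_upd, auto simp: env_def)
            fix s assume s: "s x = j - 1 \<and> env vs xs s"
            then have "env vs (xs @ [?v]) s"
              using j *(2) unfolding env_snoc by (auto simp: x_def)
            from c1[OF this] show "runs ?w (Seq c (Cond 0 (Const x 0) (Const 0 0))) s (?T + Suc 1)
                (\<lambda>s'. \<exists>j'<j. I j' s')"
            proof (rule runs_Seq)
              fix s assume s: "env vs (xs @ [?v]) s \<and> (s 0 \<noteq> 0 \<longleftrightarrow> P G L (xs @ [?v]))"
              then have e: "env vs xs s" "s x < ?n" "vs ! s x = ?v"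
                using *(2) unfolding env_snoc by (auto simp: x_def)
              \<comment> \<open>The run of \<open>c\<close> may write to register \<open>x\<close>,
                but the restored environment and the distinctness of \<open>vs\<close> fix its
                value.\<close>
              have "s x = j - 1"
                using nth_eq_iff_index_eq[OF dist, of "s x" "j - 1"] e(2,3) j(1,2) by simp
              note e = e(1) this
              show "runs ?w (Cond 0 (Const x 0) (Const 0 0)) s (Suc 1) (\<lambda>s'. \<exists>j'<j. I j' s')"
              proof (rule runs_Cond; rule runs_basic)
                assume "s 0 \<noteq> 0"
                then have "I 0 (s(x := 0))"
                  using s e v *(2) by (auto simp: I_def env_upd x_def)
                then show "\<exists>j'<j. I j' (s(x := 0))"
                  using j by blast
              next
                assume "s 0 = 0"
                moreover have "\<not> P G L (xs @ [vs ! a])" if "j - 1 \<le> a" "a < ?n" for a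
                  using nP[of a] that s \<open>s 0 = 0\<close> by (cases "a = j - 1") auto
                ultimately have "I (j - 1) (s(0 := 0))"
                  using e j *(2) by (auto simp: I_def env_upd x_def)
                then show "\<exists>j'<j. I j' (s(0 := 0))"
                  using j by (intro exI[of _ "j - 1"]) simp
              qed auto
            qed
          qed
        qed
        then show "runs ?w (While x body) s (Suc (?n * Suc (1 + (?T + Suc 1))))
            (\<lambda>s'. env vs xs s' \<and> (s' 0 \<noteq> 0 \<longleftrightarrow> (\<exists>v\<in>pverts G. P G L (xs @ [v]))))"
          by (rule runs_mono) (auto simp: I_def V in_set_conv_nth split: if_splits)
      qed
    qed
    then show "runs ?w (Seq (Const 0 0) (Seq (Add x 2 0) (While x body))) s
        (poly (2 + (1 + [:0, 1:] * (p + 4))) (length ?w))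
        (\<lambda>s'. env vs xs s' \<and> (s' 0 \<noteq> 0 \<longleftrightarrow> (\<exists>v\<in>pverts G. P G L (xs @ [v]))))"
    proof (rule runs_mono)
      have "?n * (?T + 4) \<le> length ?w * (?T + 4)"
        by (intro mult_right_mono length_vs_le) auto
      moreover have "1 + (1 + Suc (?n * Suc (1 + (?T + Suc 1)))) = 3 + ?n * (?T + 4)"
        by (simp add: algebra_simps)
      moreover have "poly (2 + (1 + [:0, 1:] * (p + 4))) (length ?w) = 3 + length ?w * (?T + 4)"
        by (simp add: algebra_simps)
      ultimately show "1 + (1 + Suc (?n * Suc (1 + (?T + Suc 1)))) \<le>
          poly (2 + (1 + [:0, 1:] * (p + 4))) (length ?w)"
        by linarith
    qed auto
  qed
qed

section \<open>Atomic formulas\<close>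

text \<open>Distinctness of \<open>vs\<close> reduces equality of vertices to equality of positions,
  that is, to both truncated differences being 0.\<close>

lemma decidable_eq:
  assumes "i < m" "j < m"
  shows "decidable r m (\<lambda>G L xs. xs ! i = xs ! j)"
proof -
  let ?c = "Seq (Sub 3 (6+i) (6+j)) (Seq (Sub 4 (6+j) (6+i)) (Seq (Add 3 3 4) (Sub 0 1 3)))"
  show ?thesis
  proof (rule decidableI[of _ _ ?c 4])
    fix vs G L xs s
    assume *: "(vs, G, L) \<in> list_instances r" "length xs = m" "env vs xs s"
    let ?w = "encode r (vs, G, L)"
    have "distinct vs"
      using * by (auto simp: list_instances_def)
    moreover have "s (6+i) < length vs" "vs ! s (6+i) = xs ! i"
        "s (6+j) < length vs" "vs ! s (6+j) = xs ! j"
      using * assms by (auto simp: env_def)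
    ultimately have iff: "s (6+i) = s (6+j) \<longleftrightarrow> xs ! i = xs ! j"
      using nth_eq_iff_index_eq[of vs "s (6+i)" "s (6+j)"] by simp
    have sub: "Suc 0 \<le> a - b + (b - a) \<longleftrightarrow> a \<noteq> b" for a b :: nat
      by arith
    have s1: "s 1 = 1"
      using * by (simp add: env_def)
    have "runs ?w ?c s
       (Suc (Suc (Suc 1))) (\<lambda>s'. env vs xs s' \<and> (s' 0 \<noteq> 0 \<longleftrightarrow> xs ! i = xs ! j))"
      using * s1 by (intro runs_Seq_basic runs_basic) (simp_all add: env_upd iff sub)
    then show "runs ?w ?c s
       (poly 4 (length ?w)) (\<lambda>s'. env vs xs s' \<and> (s' 0 \<noteq> 0 \<longleftrightarrow> xs ! i = xs ! j))"
      by (rule runs_mono) auto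
  qed
qed

text \<open>Row-major addressing of a matrix.\<close>

lemma nth_map_product:
  assumes "a < length xs" "b < length ys"
  shows "map f (List.product xs ys) ! (a * length ys + b) = f (xs ! a, ys ! b)"
    and "a * length ys + b < length xs * length ys"
proof -
  have "a * length ys + b < Suc a * length ys"
    using assms by simp
  also have "\<dots> \<le> length xs * length ys"
    using assms by (intro mult_right_mono) auto
  finally show *: "a * length ys + b < length xs * length ys" .
  have "b div length ys = 0" "length ys > 0"
    using assms by auto
  then show "map f (List.product xs ys) ! (a * length ys + b) = f (xs ! a, ys ! b)"
    using * assms by (simp add: product_nth)
qed

text \<open>The offset \<open>Suc (length vs)\<close> skips the unary vertex count and its
  separator.\<close>

lemma input_at_arc:
  assumes "a < length vs" "b < length vs"
  shows "input_at (encode r (vs, G, L)) (Suc (length vs) + b + a * length vs) =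
    of_bool ((vs ! a, vs ! b) \<in> parcs G)"
  using nth_map_product(2)[OF assms] nth_map_product(1)[OF assms, of "\<lambda>(u, v). (u, v) \<in> parcs G"]
  by (simp add: encode.simps input_at_def nth_append add.commute)

text \<open>Here the adjacency matrix is skipped as well. Colours start at 1, so column
  \<open>b\<close> belongs to colour \<open>Suc b\<close>.\<close>

lemma input_at_colour:
  assumes "a < length vs" "b < r"
  shows "input_at (encode r (vs, G, L)) (Suc (length vs) + b + length vs * length vs + a * r) =
    of_bool (Suc b \<in> L (vs ! a))"
  using nth_map_product(2)[of a vs b "[1..<Suc r]"]
    nth_map_product(1)[of a vs b "[1..<Suc r]" "\<lambda>(u, c). c \<in> L u"] assms
  by (simp add: encode.simps input_at_def nth_append ac_simps del: upt_Suc)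

lemma decidable_arc:
  assumes "i < m" "j < m"
  shows "decidable r m (\<lambda>G L xs. (xs ! i, xs ! j) \<in> parcs G)"
proof -
  \<comment> \<open>Register 3 accumulates the address; register 4 is a copy of the row position, as
    the multiplication destroys its counter.\<close>
  let ?c = "Seq (Add 3 1 2) (Seq (Add 3 3 (6+j)) (Seq (Const 0 0) (Seq (Add 4 (6+i) 0)
    (Seq (add_times 3 2 4) (Read 0 3)))))"
  show ?thesis
  proof (rule decidableI[of _ _ ?c "[:6, 3:]"])
    fix vs G L xs s
    assume *: "(vs, G, L) \<in> list_instances r" "length xs = m" "env vs xs s"
    let ?w = "encode r (vs, G, L)"
    have ij: "s (6+i) < length vs" "vs ! s (6+i) = xs ! i" "s (6+j) < length vs" "vs ! s (6+j) = xs ! j"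
      "s 1 = 1" "s 2 = length vs"
      using * assms by (auto simp: env_def)
    note inp = input_at_arc[OF ij(1,3), of r G L, unfolded ij(2,4)]
    have "runs ?w ?c s
       (Suc (Suc (Suc (Suc (Suc (s (6+i) * 3) + 1)))))
       (\<lambda>s'. env vs xs s' \<and> (s' 0 \<noteq> 0 \<longleftrightarrow> (xs ! i, xs ! j) \<in> parcs G))"
      using * inp ij by (intro runs_Seq_basic runs_Seq_add_times runs_basic) (auto simp: env_upd)
    then show "runs ?w ?c s (poly [:6, 3:] (length ?w))
       (\<lambda>s'. env vs xs s' \<and> (s' 0 \<noteq> 0 \<longleftrightarrow> (xs ! i, xs ! j) \<in> parcs G))"
      by (rule runs_mono) (use ij length_vs_le[of vs r G L] in auto)
  qed
qed

lemma decidable_colour: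
  assumes "i < m" "c \<in> {1..r}"
  shows "decidable r m (\<lambda>G L xs. c \<in> L (xs ! i))"
proof -
  obtain b where b: "c = Suc b" "b < r"
    using assms by (cases c) auto
  \<comment> \<open>Starting from \<open>c = Suc b\<close> accounts for the separator. The first
    product adds the size of the adjacency matrix, the second the rows of length \<open>r\<close>
    before the vertex.\<close>
  let ?c = "Seq (Const 3 c) (Seq (Add 3 3 2) (Seq (Const 0 0) (Seq (Add 4 2 0) (Seq (add_times 3 2 4)
    (Seq (Const 5 r) (Seq (Add 4 (6+i) 0) (Seq (add_times 3 5 4) (Read 0 3))))))))"
  show ?thesis
  proof (rule decidableI[of _ _ ?c "[:9, 6:]"])
    fix vs G L xs s
    assume *: "(vs, G, L) \<in> list_instances r" "length xs = m" "env vs xs s"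
    let ?w = "encode r (vs, G, L)"
    have ij: "s (6+i) < length vs" "vs ! s (6+i) = xs ! i"
      "s 1 = 1" "s 2 = length vs"
      using * assms by (auto simp: env_def)
    note inp = input_at_colour[OF ij(1) b(2), of G L, unfolded ij(2)]
    have "runs ?w ?c s
       (Suc (Suc (Suc (Suc (Suc (s 2 * 3) + (Suc (Suc (Suc (s (6+i) * 3) + 1))))))))
       (\<lambda>s'. env vs xs s' \<and> (s' 0 \<noteq> 0 \<longleftrightarrow> c \<in> L (xs ! i)))"
      using * inp ij b by (intro runs_Seq_basic runs_Seq_add_times runs_basic) (auto simp: env_upd add_ac)
    then show "runs ?w ?c s (poly [:9, 6:] (length ?w))
       (\<lambda>s'. env vs xs s' \<and> (s' 0 \<noteq> 0 \<longleftrightarrow> c \<in> L (xs ! i)))"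
      by (rule runs_mono) (use ij length_vs_le[of vs r G L] in auto)
  qed
qed

section \<open>Derived connectives and quantifiers\<close>

text \<open>The set \<open>A\<close> does not depend on the instance, so the quantifier is unrolled
  into a disjunction inside the program.\<close>

lemma decidable_ex_finite:
  assumes "finite A" "\<And>a. a \<in> A \<Longrightarrow> decidable r m (P a)"
  shows "decidable r m (\<lambda>G L xs. \<exists>a\<in>A. P a G L xs)"
  using assms
proof (induction A)
  case empty
  show ?case
    by (rule decidable_cong[OF decidable_const[of r m False]]) simp
next
  case (insert a A)
  have "decidable r m (\<lambda>G L xs. \<not> (\<not> P a G L xs \<and> \<not> (\<exists>a\<in>A. P a G L xs)))"
    using insert by (intro decidable_not decidable_and) auto
  then show ?case
    by (rule decidable_cong) auto
qed

lemma decidable_all_finite: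
  assumes "finite A" "\<And>a. a \<in> A \<Longrightarrow> decidable r m (P a)"
  shows "decidable r m (\<lambda>G L xs. \<forall>a\<in>A. P a G L xs)"
proof -
  have "decidable r m (\<lambda>G L xs. \<not> (\<exists>a\<in>A. \<not> P a G L xs))"
    using assms by (intro decidable_not decidable_ex_finite) auto
  then show ?thesis
    by (rule decidable_cong) auto
qed

lemma decidable_or:
  assumes "decidable r m P" "decidable r m Q"
  shows "decidable r m (\<lambda>G L xs. P G L xs \<or> Q G L xs)"
proof -
  have "decidable r m (\<lambda>G L xs. \<not> (\<not> P G L xs \<and> \<not> Q G L xs))"
    using assms by (intro decidable_not decidable_and)
  then show ?thesis
    by (rule decidable_cong) auto
qed

lemma decidable_all:
  assumes "decidable r (Suc m) P"
  shows "decidable r m (\<lambda>G L xs. \<forall>v\<in>pverts G. P G L (xs @ [v]))"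
proof -
  have "decidable r m (\<lambda>G L xs. \<not> (\<exists>v\<in>pverts G. \<not> P G L (xs @ [v])))"
    by (rule decidable_not, rule decidable_ex, rule decidable_not, rule assms)
  then show ?thesis
    by (rule decidable_cong) auto
qed

text \<open>As \<open>j\<close> is fixed, the tuple is \<open>j\<close> nested vertex quantifiers,
  the outermost one binding its first entry.\<close>

lemma decidable_ex_list:
  assumes "decidable r (m + j) P"
  shows "decidable r m
    (\<lambda>G L xs. \<exists>ys. length ys = j \<and> set ys \<subseteq> pverts G \<and> P G L (xs @ ys))"
  using assms
proof (induction j arbitrary: m)
  case 0
  then show ?case
    by (auto elim: decidable_cong)
next
  case (Suc j)
  have "decidable r (Suc m)
      (\<lambda>G L xs. \<exists>ys. length ys = j \<and> set ys \<subseteq> pverts G \<and> P G L (xs @ ys))"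
    using Suc by simp
  then have "decidable r m (\<lambda>G L xs. \<exists>v\<in>pverts G.
      \<exists>ys. length ys = j \<and> set ys \<subseteq> pverts G \<and> P G L ((xs @ [v]) @ ys))"
    by (rule decidable_ex)
  then show ?case
  proof (rule decidable_cong)
    fix G :: "nat pair_pre_digraph" and L xs
    show "(\<exists>v\<in>pverts G. \<exists>ys. length ys = j \<and> set ys \<subseteq> pverts G \<and> P G L ((xs @ [v]) @ ys)) =
        (\<exists>ys. length ys = Suc j \<and> set ys \<subseteq> pverts G \<and> P G L (xs @ ys))" (is "?l = ?r")
    proof
      assume ?l
      then obtain v ys where "v \<in> pverts G" "length ys = j" "set ys \<subseteq> pverts G"
          "P G L ((xs @ [v]) @ ys)" by blast
      then show ?r
        by (intro exI[of _ "v # ys"]) auto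
    next
      assume ?r
      then obtain v ys where "v \<in> pverts G" "length ys = j" "set ys \<subseteq> pverts G"
          "P G L (xs @ v # ys)" unfolding length_Suc_conv by auto
      then show ?l
        by (intro bexI[of _ v] exI[of _ ys]) auto
    qed
  qed
qed

section \<open>Formulas for distance, closedness and local colourability\<close>

lemma decidable_relpow:
  assumes "i < m" "j < m"
  shows "decidable r m (\<lambda>G L xs. (xs ! i, xs ! j) \<in> ((parcs G)\<^sup>=) ^^ l)"
  using assms
proof (induction l arbitrary: m j)
  case 0
  then show ?case by (auto intro: decidable_eq)
next
  case (Suc l)
  \<comment> \<open>The new variable, at index \<open>m\<close>, is the point before the last move;
    the equality stands for staying put.\<close>
  have "decidable r m (\<lambda>G L xs. \<exists>v\<in>pverts G.
      ((xs @ [v]) ! i, (xs @ [v]) ! m) \<in> ((parcs G)\<^sup>=) ^^ l \<and>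
      (((xs @ [v]) ! m, (xs @ [v]) ! j) \<in> parcs G \<or> (xs @ [v]) ! m = (xs @ [v]) ! j))"
    using Suc by (intro decidable_ex decidable_and decidable_or decidable_arc decidable_eq) auto
  then show ?case
  proof (rule decidable_cong)
    fix vs G L xs
    assume I: "(vs, G, L) \<in> list_instances r" and xs: "length xs = m" "set xs \<subseteq> pverts G"
    then interpret pair_graph G by (simp add: list_instances_def)
    \<comment> \<open>The formula quantifies over vertices only, so the intermediate point of the
      composition has to be shown to be one.\<close>
    have "xs ! j \<in> pverts G"
      using xs Suc.prems by auto
    then have "(z, xs ! j) \<in> (parcs G)\<^sup>= \<Longrightarrow> z \<in> pverts G" for z
      by (auto dest: in_arcsD1)
    with xs(1) Suc.prems show "(\<exists>v\<in>pverts G.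
      ((xs @ [v]) ! i, (xs @ [v]) ! m) \<in> ((parcs G)\<^sup>=) ^^ l \<and>
      (((xs @ [v]) ! m, (xs @ [v]) ! j) \<in> parcs G \<or> (xs @ [v]) ! m = (xs @ [v]) ! j)) =
      ((xs ! i, xs ! j) \<in> ((parcs G)\<^sup>=) ^^ Suc l)"
      by (auto simp: nth_append)
  qed
qed

text \<open>Heads of arcs are vertices, so it suffices to test each vertex \<open>v\<close> (index
  \<open>m\<close>): no arc from the tuple leads to it, or it occurs in the tuple.\<close>

lemma decidable_closed: "decidable r m (\<lambda>G L xs. parcs G `` set xs \<subseteq> set xs)"
proof -
  have "decidable r m (\<lambda>G L xs. \<forall>v\<in>pverts G.
      (\<forall>i\<in>{..<m}. \<not> ((xs @ [v]) ! i, (xs @ [v]) ! m) \<in> parcs G) \<or>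
      (\<exists>i\<in>{..<m}. (xs @ [v]) ! i = (xs @ [v]) ! m))"
    by (intro decidable_all decidable_or decidable_all_finite decidable_ex_finite decidable_not
        decidable_arc decidable_eq) auto
  then show ?thesis
  proof (rule decidable_cong)
    fix vs G L xs
    assume I: "(vs, G, L) \<in> list_instances r" and xs: "length xs = m" "set xs \<subseteq> pverts G"
    then interpret pair_graph G by (simp add: list_instances_def)
    have "(\<forall>i\<in>{..<m}. \<not> ((xs @ [v]) ! i, (xs @ [v]) ! m) \<in> parcs G) \<longleftrightarrow> v \<notin> parcs G `` set xs"
      "(\<exists>i\<in>{..<m}. (xs @ [v]) ! i = (xs @ [v]) ! m) \<longleftrightarrow> v \<in> set xs" for v
      using xs(1) by (auto simp: nth_append set_conv_nth)
    moreover have "parcs G `` set xs \<subseteq> pverts G"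
      by (auto dest: in_arcsD2)
    ultimately show "(\<forall>v\<in>pverts G.
      (\<forall>i\<in>{..<m}. \<not> ((xs @ [v]) ! i, (xs @ [v]) ! m) \<in> parcs G) \<or>
      (\<exists>i\<in>{..<m}. (xs @ [v]) ! i = (xs @ [v]) ! m)) = (parcs G `` set xs \<subseteq> set xs)"
      by (simp only:) blast
  qed
qed

text \<open>Replaces the colouring of a set by a list of colours along the tuple, of which there are
  finitely many for a fixed length. Entries may repeat, so different colours must demand different
  vertices; this makes the colouring well defined.\<close>

lemma locally_colourable_set_iff:
  assumes L: "\<And>u. u \<in> set xs \<Longrightarrow> L u \<subseteq> {1..r}"
  shows "locally_colourable l G L (set xs) \<longleftrightarrow>
    (\<exists>cs\<in>{cs. set cs \<subseteq> {1..r} \<and> length cs = length xs}. \<forall>i\<in>{..<length xs}. cs ! i \<in> L (xs ! i) \<and>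
      (\<forall>j\<in>{..<length xs}. if cs ! i = cs ! j
        then (xs ! i, xs ! j) \<in> ((parcs G)\<^sup>=) ^^ l \<longrightarrow> xs ! i = xs ! j
        else xs ! i \<noteq> xs ! j))" (is "?l = ?r")
proof
  assume ?l
  then obtain \<phi> where \<phi>: "\<And>u. u \<in> set xs \<Longrightarrow> \<phi> u \<in> L u"
    "\<And>u v. u \<in> set xs \<Longrightarrow> v \<in> set xs \<Longrightarrow> (u, v) \<in> ((parcs G)\<^sup>=) ^^ l \<Longrightarrow> u \<noteq> v \<Longrightarrow> \<phi> u \<noteq> \<phi> v"
    unfolding locally_colourable_def by blast
  show ?r
  proof (rule bexI[of _ "map \<phi> xs"])
    show "map \<phi> xs \<in> {cs. set cs \<subseteq> {1..r} \<and> length cs = length xs}"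
      using \<phi>(1) L by fastforce
  qed (use \<phi> nth_mem in fastforce)
next
  assume ?r
  then obtain cs where main: "\<forall>i\<in>{..<length xs}. cs ! i \<in> L (xs ! i) \<and>
      (\<forall>j\<in>{..<length xs}. if cs ! i = cs ! j
        then (xs ! i, xs ! j) \<in> ((parcs G)\<^sup>=) ^^ l \<longrightarrow> xs ! i = xs ! j
        else xs ! i \<noteq> xs ! j)" by blast
  have cs1: "cs ! i \<in> L (xs ! i)" if "i < length xs" for i
    using main that by blast
  have cs2: "if cs ! i = cs ! j
      then (xs ! i, xs ! j) \<in> ((parcs G)\<^sup>=) ^^ l \<longrightarrow> xs ! i = xs ! j
      else xs ! i \<noteq> xs ! j" if "i < length xs" "j < length xs" for i j
    using main that by blast
  \<comment> \<open>Any index of \<open>u\<close> may be chosen: by \<open>cs2\<close> all of them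
    carry the same colour.\<close>
  define \<phi> where "\<phi> u = cs ! (SOME i. i < length xs \<and> xs ! i = u)" for u
  have \<phi>: "\<phi> (xs ! i) = cs ! i" if "i < length xs" for i
  proof -
    have "(SOME j. j < length xs \<and> xs ! j = xs ! i) < length xs \<and>
        xs ! (SOME j. j < length xs \<and> xs ! j = xs ! i) = xs ! i"
      by (rule someI[of _ i]) (use that in simp)
    then show ?thesis
      unfolding \<phi>_def using cs2[OF that] by (metis (lifting))
  qed
  show ?l
    unfolding locally_colourable_def
  proof (intro exI[of _ \<phi>] ballI conjI impI)
    fix u assume "u \<in> set xs"
    then obtain i where i: "i < length xs" "u = xs ! i"
      by (auto simp: in_set_conv_nth)
    then show "\<phi> u \<in> L u"
      using cs1 \<phi> by simp
    fix v assume "v \<in> set xs" and uv: "(u, v) \<in> ((parcs G)\<^sup>=) ^^ l \<and> u \<noteq> v"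
    then obtain j where j: "j < length xs" "v = xs ! j"
      by (auto simp: in_set_conv_nth)
    show "\<phi> u \<noteq> \<phi> v"
      using cs2[OF i(1) j(1)] uv i j \<phi> by metis
  qed
qed

lemma decidable_locally_colourable:
  "decidable r m (\<lambda>G L xs. locally_colourable l G L (set xs))"
proof -
  \<comment> \<open>\<open>b\<close> stands for \<open>cs ! i = cs ! j\<close>, a constant once
    \<open>cs\<close> is fixed; each truth value has its own program.\<close>
  have dec: "decidable r m (\<lambda>G L xs. if b
        then (xs ! i, xs ! j) \<in> ((parcs G)\<^sup>=) ^^ l \<longrightarrow> xs ! i = xs ! j
        else xs ! i \<noteq> xs ! j)" if "i < m" "j < m" for b i j
  proof (cases b)
    case True
    have "decidable r m (\<lambda>G L xs. \<not> (xs ! i, xs ! j) \<in> ((parcs G)\<^sup>=) ^^ l \<or> xs ! i = xs ! j)"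
      using that by (intro decidable_or decidable_not decidable_relpow decidable_eq)
    then show ?thesis
      by (rule decidable_cong) (use True in auto)
  next
    case False
    have "decidable r m (\<lambda>G L xs. xs ! i \<noteq> xs ! j)"
      using that by (intro decidable_not decidable_eq)
    then show ?thesis
      by (rule decidable_cong) (use False in auto)
  qed
  have "decidable r m (\<lambda>G L xs.
    \<exists>cs\<in>{cs. set cs \<subseteq> {1..r} \<and> length cs = m}. \<forall>i\<in>{..<m}. cs ! i \<in> L (xs ! i) \<and>
      (\<forall>j\<in>{..<m}. if cs ! i = cs ! j
        then (xs ! i, xs ! j) \<in> ((parcs G)\<^sup>=) ^^ l \<longrightarrow> xs ! i = xs ! j
        else xs ! i \<noteq> xs ! j))"
    by (intro decidable_ex_finite decidable_all_finite decidable_and dec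
        decidable_colour[OF _ subsetD[OF _ nth_mem]]
        finite_lists_length_eq) auto
  then show ?thesis
  proof (rule decidable_cong)
    fix vs G L xs
    assume "(vs, G, L) \<in> list_instances r" and xs: "length xs = m" "set xs \<subseteq> pverts G"
    then have "L u \<subseteq> {1..r}" if "u \<in> set xs" for u
      using that by (auto simp: list_instances_def list_assignment_def)
    from locally_colourable_set_iff[of xs L r l G, OF this, unfolded xs(1)]
    show "(\<exists>cs\<in>{cs. set cs \<subseteq> {1..r} \<and> length cs = m}. \<forall>i\<in>{..<m}. cs ! i \<in> L (xs ! i) \<and>
      (\<forall>j\<in>{..<m}. if cs ! i = cs ! j
        then (xs ! i, xs ! j) \<in> ((parcs G)\<^sup>=) ^^ l \<longrightarrow> xs ! i = xs ! j
        else xs ! i \<noteq> xs ! j)) = locally_colourable l G L (set xs)"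
      by simp
  qed
qed

section \<open>From a sentence to a polynomial-time program\<close>

text \<open>A prologue establishes the empty environment: it puts 1 into register 1 and counts the
  unary prefix of the input in register 2. Then the program for the sentence runs.\<close>

lemma poly_time_solvable_if_decidable:
  assumes P: "decidable r 0 P" and X: "X \<subseteq> list_instances r"
    and Q: "\<And>vs G L. (vs, G, L) \<in> X \<Longrightarrow> Q (vs, G, L) \<longleftrightarrow> P G L []"
  shows "poly_time_solvable (encode r) X Q"
proof -
  obtain c p where c: "decides r 0 P c p"
    using P by (auto simp: decidable_def)
  let ?body = "Seq (Add 2 2 1) (Read 0 2)"
  let ?c = "Seq (Const 1 1) (Seq (Read 0 2) (Seq (While 0 ?body) c))"
  have "\<exists>t s. exec (encode r x) ?c (\<lambda>_. 0) t s \<and> t \<le> poly ([:3, 3:] + p) (length (encode r x)) \<and>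
      (s 0 \<noteq> 0 \<longleftrightarrow> Q x)" if "x \<in> X" for x
  proof -
    obtain vs G L where x: "x = (vs, G, L)" by (cases x)
    let ?w = "encode r x"
    let ?n = "length vs"
    have inp: "input_at ?w i = (if i < ?n then 1 else 0)" if "i \<le> ?n" for i
      using that by (auto simp: x encode.simps input_at_def nth_append)
    \<comment> \<open>\<open>j\<close> is the number of unary ones from the current position on, and
      register 0 holds the bit there. The loop stops at the separator, at position
      \<open>?n\<close>.\<close>
    define I where "I j s \<longleftrightarrow> s 1 = 1 \<and> s 2 = ?n - j \<and> j \<le> ?n \<and> s 0 = input_at ?w (s 2)"
      for j and s :: state
    have "runs ?w (Seq (While 0 ?body) c) (((\<lambda>_. 0)(1 := 1, 0 := input_at ?w 0)))
        (Suc (?n * Suc (Suc (Suc 0))) + poly p (length ?w)) (\<lambda>s. s 0 \<noteq> 0 \<longleftrightarrow> Q x)"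
    proof (rule runs_Seq)
      show "runs ?w (While 0 ?body) ((\<lambda>_. 0)(1 := 1, 0 := input_at ?w 0))
          (Suc (?n * Suc (Suc (Suc 0)))) (\<lambda>s. s 0 = 0 \<and> (\<exists>j. I j s))"
      proof (rule runs_While[where I = I])
        show "I ?n ((\<lambda>_. 0)(1 := 1, 0 := input_at ?w 0))"
          by (simp add: I_def)
        fix j s assume I: "I j s" and s0: "s 0 \<noteq> 0"
        then have "j \<noteq> 0"
          using inp[of ?n] by (intro notI) (simp add: I_def)
        then have "\<exists>j'<j. I j' (s(2 := s 2 + s 1, 0 := input_at ?w (s 2 + s 1)))"
          using I by (intro exI[of _ "j - 1"]) (auto simp: I_def)
        then show "runs ?w ?body s (Suc (Suc 0)) (\<lambda>s'. \<exists>j'<j. I j' s')"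
          by (intro runs_Seq_basic runs_basic) simp_all
      qed
      fix s assume "s 0 = 0 \<and> (\<exists>j. I j s)"
      then obtain j where "s 0 = 0" "I j s" by blast
      then have "env vs [] s"
        using inp[of "?n - j"] by (auto simp: I_def env_def split: if_splits)
      moreover have "(vs, G, L) \<in> list_instances r" and Q': "Q x \<longleftrightarrow> P G L []"
        using X Q that x by auto
      ultimately have "runs ?w c s (poly p (length ?w)) (\<lambda>s. env vs [] s \<and> (s 0 \<noteq> 0 \<longleftrightarrow> P G L []))"
        using c unfolding decides_def x by blast
      then show "runs ?w c s (poly p (length ?w)) (\<lambda>s. s 0 \<noteq> 0 \<longleftrightarrow> Q x)"
        by (rule runs_mono) (auto simp: Q')
    qed
    then have "runs ?w ?c (\<lambda>_. 0)
        (Suc (Suc (Suc (?n * Suc (Suc (Suc 0))) + poly p (length ?w)))) (\<lambda>s. s 0 \<noteq> 0 \<longleftrightarrow> Q x)"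
      by (intro runs_Seq_basic) simp
    moreover have "Suc (Suc (Suc (?n * Suc (Suc (Suc 0))) + poly p (length ?w))) \<le>
        poly ([:3, 3:] + p) (length ?w)"
      using length_vs_le[of vs r G L] by (simp add: x)
    ultimately show ?thesis
      unfolding runs_def by (meson order_trans)
  qed
  then show ?thesis
    unfolding poly_time_solvable_def by blast
qed

theorem theorem6:
  fixes d r k :: nat
  assumes "d \<ge> 6" and "r \<ge> 1"
  shows "poly_time_solvable (encode r)
           {(vs, G, L) \<in> list_instances r. induced_free (disjoint_copies k (path_graph 3)) G}
           (list_dr_colorable d r)"
proof -
  \<comment> \<open>Distance less than \<open>d\<close> means at most \<open>l\<close> moves, enough
    for two moves through a common neighbour.\<close>
  obtain l where l: "d = Suc l" "2 \<le> l"
    using \<open>d \<ge> 6\<close> by (cases d) auto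
  \<comment> \<open>The one free variable is the vertex \<open>v\<close>. The tuple length
    \<open>r ^ (4 * k)\<close> is independent of the instance, so this is a single formula.\<close>
  have "decidable r 1 (\<lambda>G L xs. \<exists>ys. length ys = r ^ (4 * k) \<and> set ys \<subseteq> pverts G \<and>
      parcs G `` set (xs @ ys) \<subseteq> set (xs @ ys) \<and> locally_colourable l G L (set (xs @ ys)))"
    by (rule decidable_ex_list, rule decidable_and, rule decidable_closed,
        rule decidable_locally_colourable)
  then have "decidable r 0 (\<lambda>G L xs. \<forall>v\<in>pverts G. \<exists>ys. length ys = r ^ (4 * k) \<and>
      set ys \<subseteq> pverts G \<and> parcs G `` set ((xs @ [v]) @ ys) \<subseteq> set ((xs @ [v]) @ ys) \<and>
      locally_colourable l G L (set ((xs @ [v]) @ ys)))"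
    unfolding One_nat_def by (rule decidable_all)
  then show ?thesis
  proof (rule poly_time_solvable_if_decidable)
    fix vs G L
    assume "(vs, G, L) \<in>
      {(vs, G, L) \<in> list_instances r. induced_free (disjoint_copies k (path_graph 3)) G}"
    then show "list_dr_colorable d r (vs, G, L) \<longleftrightarrow> (\<forall>v\<in>pverts G. \<exists>ys. length ys = r ^ (4 * k) \<and>
        set ys \<subseteq> pverts G \<and> parcs G `` set (([] @ [v]) @ ys) \<subseteq> set (([] @ [v]) @ ys) \<and>
        locally_colourable l G L (set (([] @ [v]) @ ys)))"
      using list_dr_colorable_iff_local[of vs G L r k l] l(2) assms(2) unfolding l(1) by simp
  qed auto
qed

end
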